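(* Let $(A,\omega,\tau,G)$ be a weakly mixing C*-dynamical system with $\omega$ tracial, where $G$ is a second countable (abelian) topological group, $\Sigma$ its Borel $\sigma$-algebra, $\mu$ a $\sigma$-finite measure, and such that $$G^{2}\times G^{2}\rightarrow\mathbb{C}:(g,h,j,k)\mapsto\omega\left(\tau_{h}(a_{1})\tau_{g}(a_{2})\tau_{gh}(a_{3})\tau_{jk}(a_{4})\tau_{j}(a_{5})\tau_{k}(a_{6})\right)$$ is $\Sigma^{2}\times\Sigma^{2}$-measurable for all $a_1,\dots,a_6\in A$. Assume the existence of uniform Følner sequences $(\Lambda_{1,n})$ and $(\Lambda_{2,n})$ in $G$ satisfying the Tempel'man condition and such that $(\Lambda_{1,n}^{-1}\Lambda_{1,n})$ and $(\Lambda_{2,n}^{-1}\Lambda_{2,n})$ are also Følner in $G$. Let $\varepsilon>0$ be given and consider any $a,b,c,d\in A$. (1) If $(A,\omega,\tau,G)$ is asymptotically abelian with respect to $(\Lambda_{1,n})$, then there is an $n_0\in\mathbb{N}$ such that for every $n>n_0$ $$\left|\omega\left(\tau_{gh}(a)\tau_{g}(b)\tau_{h}(c)d\right)\right|>\left|\omega(a)\omega(b)\omega(c)\omega(d)\right|-\varepsilon$$ for some $g\in\Lambda_{2,n}$ and some $h\in\Lambda_{1,n}$. (2) If $\mu$ is the counting measure, and $(A,\omega,\tau,G)$ is uniformly asymptotically abelian with respect to $(\Lambda_{1,n})$, then there is an $n\in\mathbb{N}$ such that for every $g_1,g_2\in G$ we have $$\left|\omega\left(\tau_{gh}(a)\tau_{g}(b)\tau_{h}(c)d\right)\right|>\left|\omega(a)\omega(b)\omega(c)\omega(d)\right|-\varepsilon$$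 for some $g\in\Lambda_{2,n}g_2$ and some $h\in\Lambda_{1,n}g_1$, i.e. the set of pairs $(g,h)$ for which this inequality holds is relatively dense in $G\times G$.
   Context: A topological group is a group with a topology in which product and inverse are continuous; second countable means the topology has a countable base. For subsets $V,W$ of a group, $Vg=\{vg:v\in V\}$, $VW=\{vw:v\in V,w\in W\}$, $V^{-1}=\{v^{-1}:v\in V\}$; $\Delta$ is symmetric difference. $\Sigma^2=\Sigma\times\Sigma$ is the product $\sigma$-algebra. A set $E\subset G\times G$ is relatively dense in $G\times G$ if $FE=G\times G$ for some finite set $F\subset G\times G$. Integrals with respect to $\mu$ are written $dg$. A right invariant measure group $(G,\Sigma,\mu)$ is a group $G$ with a $\sigma$-algebra $\Sigma$ in $G$ and a positive measure $\mu$ on $\Sigma$ such that $Vg\in\Sigma$ and $\mu(Vg)=\mu(V)$ for all $V\in\Sigma$, $g\in G$. A net (or sequence) $(\Lambda_\alpha)$ of subsets of $G$, with $\Lambda_\alpha\in\Sigma$ for $\alpha$ large enough, is Følner in $G$ if $0<\mu(\Lambda_\alpha)<\infty$ for $\alpha$ large enough and $\lim_\alpha\mu(\Lambda_\alpha\Delta(\Lambda_\alpha g))/\mu(\Lambda_\alpha)=0$ for all $g\in G$. It is uniform Følner if moreover $\lim_\alpha\frac{1}{\mu(\Lambda_\alpha)}\sup_{g\in\Lambda_\beta}\mu(\Lambda_\alpha\Delta(\Lambda_\alpha g))=0$ for $\beta$ large enough. It satisfies the Tempel'man condition if there is a real $c>0$ with $\mu(\Lambda_\alpha^{-1}\Lambda_\alpha)\le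 c\,\mu(\Lambda_\alpha)$ for $\alpha$ large enough (in particular $\Lambda_\alpha^{-1}\Lambda_\alpha\in\Sigma$ for $\alpha$ large enough). C*-dynamical system $(A,\omega,\tau,G)$: $A$ is a unital C*-algebra, $\omega$ a state on $A$, $(G,\Sigma,\mu)$ a right invariant measure group possessing a Følner net, with $G$ abelian (written multiplicatively, identity $e$), such that $\mathcal I:g\mapsto g^{-1}$ is measurable ($\mathcal I^{-1}(\Sigma)\subset\Sigma$) and $\mu\circ\mathcal I=\mu$; $\tau:G\to\mathrm{Aut}(A)$, $g\mapsto\tau_g$, takes values in the $*$-automorphisms of $A$, $\tau_e=\mathrm{id}$, $\tau_g\circ\tau_h=\tau_{gh}$, $\omega\circ\tau_g=\omega$ for all $g,h\in G$, and $g\mapsto\omega(a\tau_g(b))$ is $\Sigma$-measurable for all $a,b\in A$. $\omega$ is tracial if $\omega(ab)=\omega(ba)$ for all $a,b\in A$. The system is weakly mixing if for some (equivalently, every) Følner net $(\Lambda_\alpha)$ in $G$, $\lim_\alpha\frac1{\mu(\Lambda_\alpha)}\int_{\Lambda_\alpha}|\omega(a\tau_g(b))-\omega(a)\omega(b)|\,dg=0$ for all $a,b\in A$. Let $[a,b]=ab-ba$ and let $(\Lambda_\alpha)$ be a Følner net in $G$. The system is asymptotically abelian with respect to $(\Lambda_\alpha)$ if $g\mapsto\|[a,\tau_g(b)]\|$ is $\Sigma$-measurable and $\lim_\alpha\frac1{\mu(\Lambda_\alpha)}\int_{\Lambda_\alpha}\|[a,\tau_g(b)]\|\,dg=0$ for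 all $a,b\in A$. It is uniformly asymptotically abelian with respect to $(\Lambda_\alpha)$ if $g\mapsto\|[a,\tau_g(b)]\|$ is $\Sigma$-measurable and $\lim_\alpha\sup_{h\in G}\frac1{\mu(\Lambda_\alpha)}\int_{\Lambda_\alpha h}\|[a,\tau_g(b)]\|\,dg=0$ for all $a,b\in A$. *)

theory Defs
  imports "HOL-Analysis.Analysis"
begin

section \<open>Unital C*-algebras, states, automorphisms\<close>

text \<open>
  The underlying class asks for \<open>norm 1 = 1\<close>, so the zero algebra is excluded; it has no states.
\<close>

class cstar_algebra = real_normed_algebra_1 + banach +
  fixes scaleC :: "complex \<Rightarrow> 'a \<Rightarrow> 'a" (infixr \<open>*\<^sub>C\<close> 75)
    and star :: "'a \<Rightarrow> 'a"
  assumes scaleC_add_right: "c *\<^sub>C (x + y) = c *\<^sub>C x + c *\<^sub>C y"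
    and scaleC_add_left: "(c + d) *\<^sub>C x = c *\<^sub>C x + d *\<^sub>C x"
    and scaleC_scaleC: "c *\<^sub>C (d *\<^sub>C x) = (c * d) *\<^sub>C x"
    and scaleC_of_real: "complex_of_real r *\<^sub>C x = r *\<^sub>R x"
    and norm_scaleC: "norm (c *\<^sub>C x) = cmod c * norm x"
    and mult_scaleC_left: "(c *\<^sub>C x) * y = c *\<^sub>C (x * y)"
    and mult_scaleC_right: "x * (c *\<^sub>C y) = c *\<^sub>C (x * y)"
    and star_add: "star (x + y) = star x + star y"
    and star_scaleC: "star (c *\<^sub>C x) = cnj c *\<^sub>C star x"
    and star_mult: "star (x * y) = star y * star x"
    and star_star: "star (star x) = x"
    and cstar_identity: "norm (star x * x) = (norm x)\<^sup>2"

locale state =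
  fixes \<omega> :: "'a::cstar_algebra \<Rightarrow> complex"
  assumes state_add: "\<omega> (x + y) = \<omega> x + \<omega> y"
    and state_scaleC: "\<omega> (c *\<^sub>C x) = c * \<omega> x"
    and state_positive: "\<omega> (star x * x) \<in> \<real>\<^sub>\<ge>\<^sub>0"
    and state_one: "\<omega> 1 = 1"

definition tracial :: "('a::cstar_algebra \<Rightarrow> complex) \<Rightarrow> bool" where
  "tracial \<omega> \<longleftrightarrow> (\<forall>a b. \<omega> (a * b) = \<omega> (b * a))"

locale star_automorphism =
  fixes \<phi> :: "'a::cstar_algebra \<Rightarrow> 'a"
  assumes aut_bij: "bij \<phi>"
    and aut_add: "\<phi> (x + y) = \<phi> x + \<phi> y"
    and aut_scaleC: "\<phi> (c *\<^sub>C x) = c *\<^sub>C \<phi> x"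
    and aut_mult: "\<phi> (x * y) = \<phi> x * \<phi> y"
    and aut_star: "\<phi> (star x) = star (\<phi> x)"

definition commutator :: "'a::ring \<Rightarrow> 'a \<Rightarrow> 'a" where
  "commutator a b = a * b - b * a"


section \<open>Right invariant measure groups and Folner nets\<close>

text \<open>
  Groups are written additively, as in the library's classes of topological groups: \<open>g + h\<close> is the
  product of \<open>g\<close> and \<open>h\<close>, \<open>- g\<close> the inverse of \<open>g\<close>, and \<open>0\<close> the identity.
  The three operations below are thus \<open>V g\<close>, \<open>V W\<close> and \<open>V\<inverse> V\<close> in multiplicative notation.
\<close>

definition right_translate :: "'g::group_add set \<Rightarrow> 'g \<Rightarrow> 'g set" where
  "right_translate V g = {v + g | v. v \<in> V}"

definition product_set :: "'g::group_add set \<Rightarrow> 'g set \<Rightarrow> 'g set" where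
  "product_set V W = {v + w | v w. v \<in> V \<and> w \<in> W}"

definition quotient_set :: "'g::group_add set \<Rightarrow> 'g set" where
  "quotient_set V = product_set {- v | v. v \<in> V} V"

definition relatively_dense :: "'g::group_add set \<Rightarrow> bool" where
  "relatively_dense E \<longleftrightarrow> (\<exists>F. finite F \<and> product_set F E = UNIV)"

locale right_invariant_measure_group =
  fixes \<mu> :: "'g::group_add measure"
  assumes space_UNIV: "space \<mu> = UNIV"
    and right_translate_sets: "V \<in> sets \<mu> \<Longrightarrow> right_translate V g \<in> sets \<mu>"
    and emeasure_right_translate: "V \<in> sets \<mu> \<Longrightarrow> emeasure \<mu> (right_translate V g) = emeasure \<mu> V"

text \<open>
  A net is a family \<open>\<Lambda>\<close> of sets together with a proper filter \<open>F\<close> on its index type; for a directed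
  index set, \<open>F\<close> is generated by the tails, and \<open>for \<alpha> large enough\<close> means eventually along \<open>F\<close>.
  A sequence is the case \<open>F = sequentially\<close>.
\<close>

definition folner_net :: "'g::group_add measure \<Rightarrow> 'i filter \<Rightarrow> ('i \<Rightarrow> 'g set) \<Rightarrow> bool" where
  "folner_net \<mu> F \<Lambda> \<longleftrightarrow>
     F \<noteq> bot \<and>
     (\<forall>\<^sub>F \<alpha> in F. \<Lambda> \<alpha> \<in> sets \<mu> \<and> 0 < emeasure \<mu> (\<Lambda> \<alpha>) \<and> emeasure \<mu> (\<Lambda> \<alpha>) < \<infinity>) \<and>
     (\<forall>g. ((\<lambda>\<alpha>. emeasure \<mu> (sym_diff (\<Lambda> \<alpha>) (right_translate (\<Lambda> \<alpha>) g)) / emeasure \<mu> (\<Lambda> \<alpha>))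
            \<longlongrightarrow> 0) F)"

definition uniform_folner_net :: "'g::group_add measure \<Rightarrow> 'i filter \<Rightarrow> ('i \<Rightarrow> 'g set) \<Rightarrow> bool" where
  "uniform_folner_net \<mu> F \<Lambda> \<longleftrightarrow>
     folner_net \<mu> F \<Lambda> \<and>
     (\<forall>\<^sub>F \<beta> in F.
        ((\<lambda>\<alpha>. (SUP g\<in>\<Lambda> \<beta>. emeasure \<mu> (sym_diff (\<Lambda> \<alpha>) (right_translate (\<Lambda> \<alpha>) g)))
               / emeasure \<mu> (\<Lambda> \<alpha>)) \<longlongrightarrow> 0) F)"

definition tempelman :: "'g::group_add measure \<Rightarrow> 'i filter \<Rightarrow> ('i \<Rightarrow> 'g set) \<Rightarrow> bool" where
  "tempelman \<mu> F \<Lambda> \<longleftrightarrow>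
     (\<exists>c::real. c > 0 \<and>
        (\<forall>\<^sub>F \<alpha> in F. quotient_set (\<Lambda> \<alpha>) \<in> sets \<mu> \<and>
           emeasure \<mu> (quotient_set (\<Lambda> \<alpha>)) \<le> ennreal c * emeasure \<mu> (\<Lambda> \<alpha>)))"


section \<open>C*-dynamical systems\<close>

text \<open>
  Existence of a net may be quantified over families indexed by the type \<open>'g set\<close> without
  loss of generality: a net \<open>\<Lambda>\<close> along \<open>F\<close> can be replaced by the identity along
  \<open>filtermap \<Lambda> F\<close>. See the lemma below, and \<open>weakly_mixingI\<close>.
\<close>

lemma folner_net_filtermap:
  "folner_net \<mu> (filtermap \<Lambda> F) (\<lambda>V. V) \<longleftrightarrow> folner_net \<mu> F \<Lambda>"
  by (simp add: folner_net_def eventually_filtermap filterlim_filtermap filtermap_bot_iff)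

locale cstar_dynamical_system =
  right_invariant_measure_group \<mu> + state \<omega>
  for \<mu> :: "'g::ab_group_add measure" and \<omega> :: "'a::cstar_algebra \<Rightarrow> complex" +
  fixes \<tau> :: "'g \<Rightarrow> 'a \<Rightarrow> 'a"
  assumes folner_exists: "\<exists>(F :: 'g set filter) \<Lambda>. folner_net \<mu> F \<Lambda>"
    and uminus_measurable: "uminus \<in> measurable \<mu> \<mu>"
    and emeasure_uminus: "V \<in> sets \<mu> \<Longrightarrow> emeasure \<mu> (uminus -` V) = emeasure \<mu> V"
    and tau_automorphism: "star_automorphism (\<tau> g)"
    and tau_zero: "\<tau> 0 = id"
    and tau_add: "\<tau> g \<circ> \<tau> h = \<tau> (g + h)"
    and omega_tau: "\<omega> \<circ> \<tau> g = \<omega>"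
    and omega_tau_measurable: "(\<lambda>g. \<omega> (a * \<tau> g b)) \<in> borel_measurable \<mu>"

text \<open>
  All averages are of non-negative measurable functions and are taken in the extended
  non-negative reals, so that no integrability side condition is hidden in them.
\<close>

definition mixing_along ::
  "'g measure \<Rightarrow> ('a::cstar_algebra \<Rightarrow> complex) \<Rightarrow> ('g \<Rightarrow> 'a \<Rightarrow> 'a) \<Rightarrow> 'i filter \<Rightarrow> ('i \<Rightarrow> 'g set) \<Rightarrow> bool" where
  "mixing_along \<mu> \<omega> \<tau> F \<Lambda> \<longleftrightarrow>
     (\<forall>a b. ((\<lambda>\<alpha>. (\<integral>\<^sup>+g\<in>\<Lambda> \<alpha>. ennreal (cmod (\<omega> (a * \<tau> g b) - \<omega> a * \<omega> b)) \<partial>\<mu>) / emeasure \<mu> (\<Lambda> \<alpha>))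
              \<longlongrightarrow> 0) F)"

definition weakly_mixing ::
  "'g::group_add measure \<Rightarrow> ('a::cstar_algebra \<Rightarrow> complex) \<Rightarrow> ('g \<Rightarrow> 'a \<Rightarrow> 'a) \<Rightarrow> bool" where
  "weakly_mixing \<mu> \<omega> \<tau> \<longleftrightarrow>
     (\<exists>(F :: 'g set filter) \<Lambda>. folner_net \<mu> F \<Lambda> \<and> mixing_along \<mu> \<omega> \<tau> F \<Lambda>)"

lemma weakly_mixingI:
  fixes F :: "'i filter"
  assumes "folner_net \<mu> F \<Lambda>" "mixing_along \<mu> \<omega> \<tau> F \<Lambda>"
  shows "weakly_mixing \<mu> \<omega> \<tau>"
proof -
  have "mixing_along \<mu> \<omega> \<tau> (filtermap \<Lambda> F) (\<lambda>V. V)"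
    using assms(2) by (simp add: mixing_along_def filterlim_filtermap)
  moreover have "folner_net \<mu> (filtermap \<Lambda> F) (\<lambda>V. V)"
    using assms(1) by (simp only: folner_net_filtermap)
  ultimately show ?thesis
    unfolding weakly_mixing_def by blast
qed

definition asymptotically_abelian ::
  "'g measure \<Rightarrow> ('g \<Rightarrow> 'a::cstar_algebra \<Rightarrow> 'a) \<Rightarrow> 'i filter \<Rightarrow> ('i \<Rightarrow> 'g set) \<Rightarrow> bool" where
  "asymptotically_abelian \<mu> \<tau> F \<Lambda> \<longleftrightarrow>
     (\<forall>a b. (\<lambda>g. norm (commutator a (\<tau> g b))) \<in> borel_measurable \<mu> \<and>
        ((\<lambda>\<alpha>. (\<integral>\<^sup>+g\<in>\<Lambda> \<alpha>. ennreal (norm (commutator a (\<tau> g b))) \<partial>\<mu>) / emeasure \<mu> (\<Lambda> \<alpha>))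
           \<longlongrightarrow> 0) F)"

definition uniformly_asymptotically_abelian ::
  "'g::group_add measure \<Rightarrow> ('g \<Rightarrow> 'a::cstar_algebra \<Rightarrow> 'a) \<Rightarrow> 'i filter \<Rightarrow> ('i \<Rightarrow> 'g set) \<Rightarrow> bool" where
  "uniformly_asymptotically_abelian \<mu> \<tau> F \<Lambda> \<longleftrightarrow>
     (\<forall>a b. (\<lambda>g. norm (commutator a (\<tau> g b))) \<in> borel_measurable \<mu> \<and>
        ((\<lambda>\<alpha>. SUP h. (\<integral>\<^sup>+g\<in>right_translate (\<Lambda> \<alpha>) h. ennreal (norm (commutator a (\<tau> g b))) \<partial>\<mu>)
                        / emeasure \<mu> (\<Lambda> \<alpha>))
           \<longlongrightarrow> 0) F)"

text \<open>
  The counting measure restricted to the \<open>\<sigma>\<close>-algebra of \<open>\<mu>\<close>, which need not contain every set.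
\<close>

definition is_counting_measure :: "'g measure \<Rightarrow> bool" where
  "is_counting_measure \<mu> \<longleftrightarrow> (\<forall>V\<in>sets \<mu>. emeasure \<mu> V = emeasure (count_space UNIV) V)"

end

theory Submission
  imports Defs
begin

text \<open>
  Almost orthogonality makes weak mixing combinatorial. Weak mixing yields finitely many \<open>p i\<close> for
  which the translates of a centred element are pairwise almost orthogonal in the GNS seminorm, so
  that their average is small when tested against any \<open>u\<close>, and hence against any translate of \<open>u\<close>.
  Applied to both group variables, this gives finite sets \<open>P\<close> and \<open>Q\<close> such that every translate
  of \<open>P \<times> Q\<close> contains a pair satisfying the inequality. A set far enough along a Folner sequence,
  or any translate of it, contains a translate of a given finite set.
\<close>

section \<open>Preliminaries: the involution and the GNS seminorm of a state\<close>

text \<open>Turns a bound on a sum of \<open>N\<close> errors into \<open>N\<close> times a bound on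
  their mean.\<close>

lemma sqrt_of_nat_mult: "N > 0 \<Longrightarrow> sqrt (real N * c) = N * sqrt (c / N)"
  by (simp add: real_sqrt_mult real_sqrt_divide field_simps)

lemma star_one [simp]: "star 1 = (1::'a::cstar_algebra)"
  by (metis mult.right_neutral star_mult star_star)

lemma additive_star: "Modules.additive (star :: 'a::cstar_algebra \<Rightarrow> 'a)"
  by standard (rule star_add)

lemmas star_diff = Modules.additive.diff [OF additive_star]
lemmas star_sum = Modules.additive.sum [OF additive_star]

context state
begin

lemma additive_state: "Modules.additive \<omega>"
  by standard (rule state_add)

lemmas state_diff = Modules.additive.diff [OF additive_state]
lemmas state_sum = Modules.additive.sum [OF additive_state]

lemma state_square: "Re (\<omega> (star x * x)) \<ge> 0" "Im (\<omega> (star x * x)) = 0"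
  using state_positive[of x] by (auto simp: complex_nonneg_Reals_iff)

lemma state_square_add:
  "\<omega> (star (x + l *\<^sub>C y) * (x + l *\<^sub>C y)) =
     \<omega> (star x * x) + l * \<omega> (star x * y) + cnj l * \<omega> (star y * x) + cnj l * l * \<omega> (star y * y)"
  by (simp add: star_add star_scaleC distrib_left distrib_right mult_scaleC_left mult_scaleC_right
      state_add state_scaleC algebra_simps)

text \<open>Polarization: the squares of x + y and of x + i y have real values, which fixes the
  imaginary and the real part respectively.\<close>

lemma state_hermitian: "\<omega> (star y * x) = cnj (\<omega> (star x * y))"
proof -
  have "Im (\<omega> (star x * y)) + Im (\<omega> (star y * x)) = 0"
    using state_square(2)[of "x + 1 *\<^sub>C y"] unfolding state_square_add
    by (simp add: state_square)
  moreover have "Re (\<omega> (star x * y)) - Re (\<omega> (star y * x)) = 0"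
    using state_square(2)[of "x + \<i> *\<^sub>C y"] unfolding state_square_add
    by (simp add: state_square)
  ultimately show ?thesis by (simp add: complex_eq_iff)
qed

lemma state_star: "\<omega> (star x) = cnj (\<omega> x)"
  using state_hermitian[of x 1] by simp

lemma state_Cauchy_Schwarz:
  "(cmod (\<omega> (star x * y)))\<^sup>2 \<le> Re (\<omega> (star x * x)) * Re (\<omega> (star y * y))"
proof -
  let ?t = "\<omega> (star x * y)" and ?A = "Re (\<omega> (star x * x))" and ?B = "Re (\<omega> (star y * y))"
  \<comment> \<open>The multiplier \<open>- r * cnj ?t\<close> cancels the phase of
    \<open>?t\<close>: both cross terms become - r |?t|^2, which leaves a real quadratic in
    \<open>r\<close>.\<close>
  have quad: "?A - 2 * r * (cmod ?t)\<^sup>2 + r\<^sup>2 * (cmod ?t)\<^sup>2 * ?B \<ge> 0" for r :: real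
  proof -
    have "0 \<le> Re (\<omega> (star (x + (- r * cnj ?t) *\<^sub>C y) * (x + (- r * cnj ?t) *\<^sub>C y)))"
      by (rule state_square)
    also have "\<dots> = ?A - 2 * r * (cmod ?t)\<^sup>2 + r\<^sup>2 * (cmod ?t)\<^sup>2 * ?B"
      unfolding state_square_add state_hermitian[of y x]
      unfolding cmod_power2 by (simp add: state_square algebra_simps power2_eq_square)
    finally show ?thesis .
  qed
  show ?thesis
  proof (cases "?B = 0")
    case True
    have "?t = 0"
    proof (rule ccontr)
      assume "?t \<noteq> 0"
      then have "(cmod ?t)\<^sup>2 > 0" by simp
      \<comment> \<open>With \<open>?B = 0\<close> the quadratic is affine in \<open>r\<close>, and
        at this \<open>r\<close> its value is -1.\<close>
      then show False
        using quad[of "(?A + 1) / (2 * (cmod ?t)\<^sup>2)"] True by (simp add: field_simps)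
    qed
    then show ?thesis using True by simp
  next
    case False
    then have "?B > 0" using state_square[of y] by simp
    \<comment> \<open>The quadratic is smallest at r = 1 / \<open>?B\<close>.\<close>
    then show ?thesis
      using quad[of "1 / ?B"] by (simp add: field_simps power2_eq_square)
  qed
qed

text \<open>Duality: suitable coefficients turn the sum of moduli into a single value of the state,
  and Cauchy-Schwarz then leaves only the Gram matrix of the \<open>v i\<close>. If its off-diagonal
  entries are of order 1/N, the bound grows like the square root of \<open>N\<close> instead of like
  \<open>N\<close>.\<close>

lemma sum_cmod_state_le:
  fixes v :: "nat \<Rightarrow> 'a"
  shows "(\<Sum>i<N. cmod (\<omega> (z * v i))) \<le>
    sqrt (Re (\<omega> (z * star z))) * sqrt (\<Sum>i<N. \<Sum>j<N. cmod (\<omega> (star (v i) * v j)))"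
proof -
  \<comment> \<open>The conjugate phase. Since \<open>sgn 0 = 0\<close>, the coefficient vanishes
    where the value does, so its modulus is only bounded by one.\<close>
  define c where "c i = cnj (sgn (\<omega> (z * v i)))" for i
  define S where "S = (\<Sum>i<N. c i *\<^sub>C v i)"
  have c_le: "cmod (c i) \<le> 1" for i
    by (simp add: c_def norm_sgn)
  have c_mult: "c i * \<omega> (z * v i) = cmod (\<omega> (z * v i))" for i
    by (cases "\<omega> (z * v i) = 0")
      (simp_all add: c_def sgn_eq mult.commute[of "cnj _"] flip: complex_norm_square,
       simp add: power2_eq_square)
  have "\<omega> (z * S) = of_real (\<Sum>i<N. cmod (\<omega> (z * v i)))"
    by (simp add: S_def sum_distrib_left state_sum mult_scaleC_right state_scaleC c_mult)
  then have "(\<Sum>i<N. cmod (\<omega> (z * v i))) = cmod (\<omega> (z * S))"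
    by (simp add: sum_nonneg del: of_real_sum)
  also have "\<dots> \<le> sqrt (Re (\<omega> (z * star z)) * Re (\<omega> (star S * S)))"
    using state_Cauchy_Schwarz[of "star z" S] by (intro real_le_rsqrt) (simp add: star_star)
  also have "Re (\<omega> (star S * S)) \<le> (\<Sum>i<N. \<Sum>j<N. cmod (\<omega> (star (v i) * v j)))"
  proof -
    have S_square: "\<omega> (star S * S) = (\<Sum>i<N. \<Sum>j<N. cnj (c i) * c j * \<omega> (star (v i) * v j))"
      unfolding S_def
      by (simp add: star_sum star_scaleC sum_product state_sum mult_scaleC_left mult_scaleC_right
          state_scaleC mult.left_commute mult.assoc)
    have "Re (\<omega> (star S * S)) \<le> cmod (\<Sum>i<N. \<Sum>j<N. cnj (c i) * c j * \<omega> (star (v i) * v j))"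
      unfolding S_square by (rule complex_Re_le_cmod)
    also have "\<dots> \<le> (\<Sum>i<N. \<Sum>j<N. cmod (cnj (c i) * c j * \<omega> (star (v i) * v j)))"
      by (intro order_trans[OF norm_sum] sum_mono norm_sum)
    also have "\<dots> \<le> (\<Sum>i<N. \<Sum>j<N. cmod (\<omega> (star (v i) * v j)))"
      by (intro sum_mono) (simp add: norm_mult mult_le_one c_le mult_left_le_one_le)
    finally show ?thesis .
  qed
  then have "sqrt (Re (\<omega> (z * star z)) * Re (\<omega> (star S * S))) \<le>
      sqrt (Re (\<omega> (z * star z)) * (\<Sum>i<N. \<Sum>j<N. cmod (\<omega> (star (v i) * v j))))"
    using state_square(1)[of "star z"] by (intro real_sqrt_le_mono mult_left_mono) (simp_all add: star_star)
  finally show ?thesis by (simp add: real_sqrt_mult)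
qed

end

section \<open>The invariant dynamics and the van der Corput estimate\<close>

context cstar_dynamical_system
begin

lemma tau_mult: "\<tau> g (x * y) = \<tau> g x * \<tau> g y"
  and tau_star: "\<tau> g (star x) = star (\<tau> g x)"
  and tau_scaleC: "\<tau> g (c *\<^sub>C x) = c *\<^sub>C \<tau> g x"
  by (simp_all add: star_automorphism.aut_mult star_automorphism.aut_star
      star_automorphism.aut_scaleC tau_automorphism)

lemma tau_diff: "\<tau> g (x - y) = \<tau> g x - \<tau> g y"
proof -
  have "Modules.additive (\<tau> g)"
    by standard (rule star_automorphism.aut_add[OF tau_automorphism])
  then show ?thesis by (rule Modules.additive.diff)
qed

lemma tau_tau: "\<tau> g (\<tau> h x) = \<tau> (g + h) x"
  using tau_add[of g h] by (simp add: fun_eq_iff)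

lemma tau_0: "\<tau> 0 x = x"
  by (simp add: tau_zero)

lemma tau_one: "\<tau> g 1 = 1"
  by (metis mult.right_neutral mult.left_neutral tau_mult tau_tau tau_0 add.right_inverse)

lemma state_tau: "\<omega> (\<tau> g x) = \<omega> x"
  using omega_tau[of g] by (simp add: fun_eq_iff)

lemma state_tau_shift: "\<omega> (\<tau> g x * \<tau> h y) = \<omega> (x * \<tau> (h - g) y)"
  using state_tau[of g "x * \<tau> (h - g) y"] by (simp add: tau_mult tau_tau)

text \<open>
  This is the van der Corput estimate with a finite set of shifts \<open>p i\<close>, in place of a Folner set.
\<close>

lemma sum_mixing_le:
  fixes p :: "nat \<Rightarrow> 'g"
  assumes "C \<ge> 0"
    and "\<And>i j. i < N \<Longrightarrow> j < N \<Longrightarrow> i \<noteq> j \<Longrightarrow>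
      cmod (\<omega> (star x * \<tau> (p j - p i) x) - \<omega> (star x) * \<omega> x) \<le> C / N"
    and "cmod (\<omega> (star x * x) - \<omega> (star x) * \<omega> x) \<le> D"
  shows "(\<Sum>i<N. cmod (\<omega> (u * \<tau> (g + p i) x) - \<omega> u * \<omega> x)) \<le>
    sqrt (Re (\<omega> (u * star u))) * sqrt (N * (C + D))"
proof -
  \<comment> \<open>Centring \<open>x\<close> makes the Gram matrix of the translates consist of the
    centred correlations of \<open>x\<close>; invariance of the state removes the common shift
    \<open>g\<close>.\<close>
  define y where "y = x - \<omega> x *\<^sub>C 1"
  define v where "v i = \<tau> (g + p i) y" for i
  have v: "v i = \<tau> (g + p i) x - \<omega> x *\<^sub>C 1" for i
    by (simp add: v_def y_def tau_diff tau_scaleC tau_one)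
  have "\<omega> (star (v i) * v j) = \<omega> (star x * \<tau> (p j - p i) x) - \<omega> (star x) * \<omega> x" for i j
  proof -
    have "\<omega> (star (v i) * v j) = \<omega> (star y * \<tau> (p j - p i) y)"
      using state_tau_shift[of "g + p i" "star y" "g + p j" y] by (simp add: v_def tau_star)
    also have "\<dots> = \<omega> (star x * \<tau> (p j - p i) x) - \<omega> (star x) * \<omega> x"
      by (simp add: y_def tau_diff tau_scaleC tau_one star_diff star_scaleC left_diff_distrib
          right_diff_distrib mult_scaleC_left mult_scaleC_right state_diff state_scaleC state_tau
          state_one state_star mult.commute)
    finally show ?thesis .
  qed
  \<comment> \<open>As \<open>C \<ge> 0\<close>, the term \<open>C / N\<close> may be added on the
    diagonal too, so the whole matrix sums to at most N^2 (C / N) + N D.\<close>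
  then have entry: "cmod (\<omega> (star (v i) * v j)) \<le> C / N + (if i = j then D else 0)"
    if "i < N" "j < N" for i j
    using assms that by (cases "i = j") (auto simp: tau_0 add_increasing)
  have "(\<Sum>i<N. \<Sum>j<N. cmod (\<omega> (star (v i) * v j))) \<le>
      (\<Sum>i<N. \<Sum>j<N. C / N + (if i = j then D else 0))"
    by (intro sum_mono entry) auto
  also have "\<dots> = N * (C + D)"
    by (simp add: sum.distrib distrib_left)
  finally have gram: "(\<Sum>i<N. \<Sum>j<N. cmod (\<omega> (star (v i) * v j))) \<le> N * (C + D)" .
  have "(\<Sum>i<N. cmod (\<omega> (u * \<tau> (g + p i) x) - \<omega> u * \<omega> x)) = (\<Sum>i<N. cmod (\<omega> (u * v i)))"
    by (simp add: v right_diff_distrib mult_scaleC_right state_diff state_scaleC mult.commute)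
  also have "\<dots> \<le> sqrt (Re (\<omega> (u * star u))) *
      sqrt (\<Sum>i<N. \<Sum>j<N. cmod (\<omega> (star (v i) * v j)))"
    by (rule sum_cmod_state_le)
  also have "\<dots> \<le> sqrt (Re (\<omega> (u * star u))) * sqrt (N * (C + D))"
    using state_square(1)[of "star u"] by (intro mult_left_mono real_sqrt_le_mono gram) (simp add: star_star)
  finally show ?thesis .
qed

section \<open>Weak mixing through finite sets of shifts\<close>

text \<open>A function whose mean over a set is below \<epsilon> is below \<epsilon> somewhere on
  it. Applying this to the sum of the errors over \<open>K\<close> treats all pairs with the same
  \<open>g\<close>.\<close>

lemma exists_mixing:
  assumes "weakly_mixing \<mu> \<omega> \<tau>" "finite K" "\<epsilon> > 0"
  shows "\<exists>g. \<forall>u v. (u, v) \<in> K \<longrightarrow> cmod (\<omega> (u * \<tau> g v) - \<omega> u * \<omega> v) < \<epsilon>"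
proof -
  obtain F and \<Lambda> :: "'g set \<Rightarrow> 'g set"
    where F: "folner_net \<mu> F \<Lambda>" "mixing_along \<mu> \<omega> \<tau> F \<Lambda>"
    using assms(1) by (auto simp: weakly_mixing_def)
  define f where "f k g = ennreal (cmod (\<omega> (fst k * \<tau> g (snd k)) - \<omega> (fst k) * \<omega> (snd k)))" for k g
  have f_meas [measurable]: "f k \<in> borel_measurable \<mu>" for k
    unfolding f_def using omega_tau_measurable[of "fst k" "snd k"] by measurable
  have "((\<lambda>\<alpha>. \<Sum>k\<in>K. (\<integral>\<^sup>+g\<in>\<Lambda> \<alpha>. f k g \<partial>\<mu>) / emeasure \<mu> (\<Lambda> \<alpha>)) \<longlongrightarrow> (\<Sum>k\<in>K. 0)) F"
    using F(2) unfolding mixing_along_def f_def by (intro tendsto_sum) auto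
  then have "\<forall>\<^sub>F \<alpha> in F. (\<Sum>k\<in>K. (\<integral>\<^sup>+g\<in>\<Lambda> \<alpha>. f k g \<partial>\<mu>) / emeasure \<mu> (\<Lambda> \<alpha>)) < ennreal \<epsilon>"
    using assms(3) by (intro order_tendstoD(2)) auto
  moreover have "\<forall>\<^sub>F \<alpha> in F. \<Lambda> \<alpha> \<in> sets \<mu> \<and> 0 < emeasure \<mu> (\<Lambda> \<alpha>) \<and> emeasure \<mu> (\<Lambda> \<alpha>) < \<infinity>"
    and "F \<noteq> bot"
    using F(1) by (auto simp: folner_net_def)
  ultimately obtain \<alpha> where \<alpha>: "\<Lambda> \<alpha> \<in> sets \<mu>" "0 < emeasure \<mu> (\<Lambda> \<alpha>)" "emeasure \<mu> (\<Lambda> \<alpha>) < \<infinity>"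
    and less: "(\<Sum>k\<in>K. (\<integral>\<^sup>+g\<in>\<Lambda> \<alpha>. f k g \<partial>\<mu>) / emeasure \<mu> (\<Lambda> \<alpha>)) < ennreal \<epsilon>"
    using eventually_happens[OF eventually_conj] by blast
  have "(\<Sum>k\<in>K. (\<integral>\<^sup>+g\<in>\<Lambda> \<alpha>. f k g \<partial>\<mu>) / emeasure \<mu> (\<Lambda> \<alpha>)) =
      (\<integral>\<^sup>+g\<in>\<Lambda> \<alpha>. (\<Sum>k\<in>K. f k g) \<partial>\<mu>) / emeasure \<mu> (\<Lambda> \<alpha>)"
    using \<alpha>(1) by (simp add: divide_ennreal_def sum_distrib_right[symmetric] nn_integral_sum[symmetric])
  note less = less[unfolded this]
  have "\<exists>g\<in>\<Lambda> \<alpha>. (\<Sum>k\<in>K. f k g) < ennreal \<epsilon>"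
  proof (rule ccontr)
    assume "\<not> ?thesis"
    then have "(\<integral>\<^sup>+g\<in>\<Lambda> \<alpha>. ennreal \<epsilon> \<partial>\<mu>) \<le> (\<integral>\<^sup>+g\<in>\<Lambda> \<alpha>. (\<Sum>k\<in>K. f k g) \<partial>\<mu>)"
      by (intro nn_integral_mono) (auto simp: indicator_def not_less)
    then have "ennreal \<epsilon> * emeasure \<mu> (\<Lambda> \<alpha>) \<le> (\<integral>\<^sup>+g\<in>\<Lambda> \<alpha>. (\<Sum>k\<in>K. f k g) \<partial>\<mu>)"
      using \<alpha>(1) by (simp add: nn_integral_cmult_indicator)
    then have "ennreal \<epsilon> * emeasure \<mu> (\<Lambda> \<alpha>) / emeasure \<mu> (\<Lambda> \<alpha>) < ennreal \<epsilon>"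
      using less by (meson divide_right_mono_ennreal le_less_trans)
    then show False
      using \<alpha>(2,3) by (simp add: ennreal_mult_divide_eq)
  qed
  then obtain g where g: "(\<Sum>k\<in>K. f k g) < ennreal \<epsilon>" by blast
  have "f k g < ennreal \<epsilon>" if "k \<in> K" for k
    using member_le_sum[OF that, of "\<lambda>k. f k g"] assms(2) g by (auto intro: le_less_trans)
  then show ?thesis
    using assms(3) by (intro exI[of _ g]) (force simp: f_def ennreal_less_iff)
qed

text \<open>The shifts are chosen one after another, each mixing relative to the earlier ones.
  Differences occur with both signs, and the trace reduces the second sign to a mixing condition on
  the new shift as well.\<close>

lemma mixing_sequence:
  assumes "weakly_mixing \<mu> \<omega> \<tau>" "tracial \<omega>" "finite B" "\<epsilon> > 0"
  shows "\<exists>p :: nat \<Rightarrow> 'g. \<forall>i<N. \<forall>j<N. i \<noteq> j \<longrightarrow>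
    (\<forall>b\<in>B. cmod (\<omega> (star b * \<tau> (p j - p i) b) - \<omega> (star b) * \<omega> b) < \<epsilon>)"
proof (induction N)
  case (Suc N)
  then obtain p where p: "\<And>i j b. i < N \<Longrightarrow> j < N \<Longrightarrow> i \<noteq> j \<Longrightarrow> b \<in> B \<Longrightarrow>
      cmod (\<omega> (star b * \<tau> (p j - p i) b) - \<omega> (star b) * \<omega> b) < \<epsilon>"
    by blast
  \<comment> \<open>The first pair controls \<open>g - p i\<close>. The second controls
    \<open>p i - g\<close>, after the trace has moved the factor shifted by \<open>g\<close> to the
    right.\<close>
  define K where "K = (\<Union>b\<in>B. \<Union>i<N. {(star b, \<tau> (- p i) b), (\<tau> (p i) b, star b)})"
  have "finite K" using assms(3) by (auto simp: K_def)
  then obtain g where g: "\<And>u v. (u, v) \<in> K \<Longrightarrow> cmod (\<omega> (u * \<tau> g v) - \<omega> u * \<omega> v) < \<epsilon>"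
    using exists_mixing[OF assms(1) _ assms(4)] by blast
  have new: "cmod (\<omega> (star b * \<tau> (g - p i) b) - \<omega> (star b) * \<omega> b) < \<epsilon>"
    "cmod (\<omega> (star b * \<tau> (p i - g) b) - \<omega> (star b) * \<omega> b) < \<epsilon>" if "b \<in> B" "i < N" for b i
  proof -
    have "(star b, \<tau> (- p i) b) \<in> K" "(\<tau> (p i) b, star b) \<in> K"
      using that by (auto simp: K_def)
    note mix = this[THEN g]
    show "cmod (\<omega> (star b * \<tau> (g - p i) b) - \<omega> (star b) * \<omega> b) < \<epsilon>"
      using mix(1) by (simp add: tau_tau state_tau)
    have "\<omega> (\<tau> (p i) b * \<tau> g (star b)) = \<omega> (star b * \<tau> (p i - g) b)"
      using assms(2) state_tau_shift[of g "star b" "p i" b] by (simp add: tracial_def)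
    then show "cmod (\<omega> (star b * \<tau> (p i - g) b) - \<omega> (star b) * \<omega> b) < \<epsilon>"
      using mix(2) by (simp add: state_tau mult.commute)
  qed
  show ?case
    using p new by (intro exI[of _ "p(N := g)"]) (auto simp: less_Suc_eq)
qed simp

text \<open>The bound of \<open>sum_mixing_le\<close> does not depend on the base point, so one
  sequence of shifts, chosen from the correlations of the second components alone, serves every
  \<open>h\<close>.\<close>

lemma uniform_mixing:
  assumes "weakly_mixing \<mu> \<omega> \<tau>" "tracial \<omega>" "finite K" "\<epsilon> > 0"
  shows "\<exists>Q. finite Q \<and>
    (\<forall>h. \<exists>q\<in>Q. \<forall>u v. (u, v) \<in> K \<longrightarrow> cmod (\<omega> (u * \<tau> (h + q) v) - \<omega> u * \<omega> v) < \<epsilon>)"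
proof -
  define U where "U k = sqrt (Re (\<omega> (fst k * star (fst k))))" for k :: "'a \<times> 'a"
  define D where "D k = cmod (\<omega> (star (snd k) * snd k) - \<omega> (star (snd k)) * \<omega> (snd k))"
    for k :: "'a \<times> 'a"
  \<comment> \<open>These terms are the bounds that \<open>sum_mixing_le\<close> with
    \<open>C = 1\<close> gives for the mean, over \<open>N\<close> shifts, of the total error over
    \<open>K\<close>.\<close>
  have "(\<lambda>N. \<Sum>k\<in>K. U k * sqrt ((1 + D k) / real N)) \<longlonglongrightarrow> (\<Sum>k\<in>K. U k * sqrt 0)"
    by (intro tendsto_sum tendsto_intros lim_const_over_n)
  then have ev: "\<forall>\<^sub>F N in sequentially. (\<Sum>k\<in>K. U k * sqrt ((1 + D k) / real N)) < \<epsilon>"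
    using assms(4) by (intro order_tendstoD(2)) auto
  obtain N where N: "N > 0" "(\<Sum>k\<in>K. U k * sqrt ((1 + D k) / real N)) < \<epsilon>"
    using eventually_happens'[OF sequentially_bot eventually_conj[OF ev eventually_gt_at_top[of 0]]]
    by auto
  obtain p :: "nat \<Rightarrow> 'g" where p: "\<And>i j b. i < N \<Longrightarrow> j < N \<Longrightarrow> i \<noteq> j \<Longrightarrow> b \<in> snd ` K \<Longrightarrow>
      cmod (\<omega> (star b * \<tau> (p j - p i) b) - \<omega> (star b) * \<omega> b) < 1 / N"
    using mixing_sequence[OF assms(1,2), of "snd ` K" "1 / N" N] assms(3) N(1) by auto
  have "\<exists>q\<in>p ` {..<N}. \<forall>u v. (u, v) \<in> K \<longrightarrow> cmod (\<omega> (u * \<tau> (h + q) v) - \<omega> u * \<omega> v) < \<epsilon>" for h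
  proof (rule ccontr)
    let ?e = "\<lambda>k i. cmod (\<omega> (fst k * \<tau> (h + p i) (snd k)) - \<omega> (fst k) * \<omega> (snd k))"
    assume contr: "\<not> ?thesis"
    \<comment> \<open>A shift that fails for some pair has total error at least \<epsilon>; if all
      shifts fail, so does the bound on the mean.\<close>
    have "\<epsilon> \<le> (\<Sum>k\<in>K. ?e k i)" if i: "i < N" for i
    proof -
      obtain k where k: "k \<in> K" "\<epsilon> \<le> ?e k i"
        using contr i by (force simp: not_less)
      then show ?thesis
        using member_le_sum[of k K "\<lambda>k. ?e k i"] assms(3) by simp
    qed
    then have "(\<Sum>i<N. \<epsilon>) \<le> (\<Sum>i<N. \<Sum>k\<in>K. ?e k i)"
      by (intro sum_mono) auto
    also have "\<dots> = (\<Sum>k\<in>K. \<Sum>i<N. ?e k i)"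
      by (rule sum.swap)
    also have "\<dots> \<le> (\<Sum>k\<in>K. U k * sqrt (N * (1 + D k)))"
      unfolding U_def using p by (intro sum_mono sum_mixing_le) (auto simp: D_def intro!: less_imp_le)
    also have "\<dots> = N * (\<Sum>k\<in>K. U k * sqrt ((1 + D k) / N))"
      using N(1) by (simp only: sqrt_of_nat_mult sum_distrib_left mult_ac)
    finally show False
      using N by simp
  qed
  then show ?thesis
    by (intro exI[of _ "p ` {..<N}"]) auto
qed

section \<open>Recurrence in both group variables\<close>

text \<open>
  Writing \<open>x = \<tau> h a * b\<close> and \<open>y = \<tau> h c * d\<close>, the value at \<open>(g, h)\<close> is \<open>\<omega> (y * \<tau> g x)\<close>. The shifts
  \<open>p\<close> in the first variable can be chosen before \<open>h\<close>, because for mixing \<open>h\<close> the correlations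
  \<open>\<omega> (star x * \<tau> s x)\<close> are close to products of correlations of \<open>a\<close> and of \<open>b\<close>.
\<close>

lemma four_fold_recurrence:
  assumes wm: "weakly_mixing \<mu> \<omega> \<tau>" and tr: "tracial \<omega>" and "\<epsilon> > 0"
  shows "\<exists>P Q. finite P \<and> finite Q \<and> (\<forall>g h. \<exists>p\<in>P. \<exists>q\<in>Q.
    cmod (\<omega> a * \<omega> b * \<omega> c * \<omega> d) - \<epsilon> <
      cmod (\<omega> (\<tau> ((g + p) + (h + q)) a * \<tau> (g + p) b * \<tau> (h + q) c * d)))"
proof -
  define A where "A = cmod (\<omega> a)"
  define B where "B = cmod (\<omega> b)"
  \<comment> \<open>\<open>C / N\<close> will bound the off-diagonal correlations of
    \<open>x\<close>, \<open>D\<close> the diagonal ones, \<open>Y\<close> the value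
    \<open>\<omega> (y * star y)\<close>, and \<open>L / N\<close> the error of replacing
    \<open>\<omega> y * \<omega> x\<close> by the product of the four values. None of these
    constants involves \<open>N\<close> or \<open>h\<close>, so \<open>N\<close> can be chosen from
    them.\<close>
  define C where "C = 1 + (A\<^sup>2 + B\<^sup>2 + 1) + (2 * A * B + 1)"
  define D where "D = cmod (\<omega> (star a * a)) * cmod (\<omega> (star b * b)) + 1 + (A * B + 1)\<^sup>2"
  define Y where "Y = cmod (\<omega> (star c * c)) * cmod (\<omega> (d * star d)) + 1"
  define L where "L = cmod (\<omega> c * \<omega> d) + 1 + A * B"
  have AB: "A \<ge> 0" "B \<ge> 0" by (auto simp: A_def B_def)
  then have C: "C \<ge> 0" by (simp add: C_def)
  have "(\<lambda>N. sqrt Y * sqrt ((C + D) / real N) + L / real N) \<longlonglongrightarrow> sqrt Y * sqrt 0 + 0"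
    by (intro tendsto_intros lim_const_over_n)
  then have ev: "\<forall>\<^sub>F N in sequentially. sqrt Y * sqrt ((C + D) / real N) + L / real N < \<epsilon>"
    using assms(3) by (intro order_tendstoD(2)) auto
  obtain N where N: "N > 0" "sqrt Y * sqrt ((C + D) / real N) + L / real N < \<epsilon>"
    using eventually_happens'[OF sequentially_bot eventually_conj[OF ev eventually_gt_at_top[of 0]]]
    by auto
  \<comment> \<open>One tolerance for the choice of \<open>p\<close> and for that of
    \<open>Q\<close>; each comparison below then costs a fixed multiple of 1/N.\<close>
  define t where "t = 1 / real N"
  have t: "0 < t" "t \<le> 1" using N(1) by (auto simp: t_def)
  obtain p :: "nat \<Rightarrow> 'g" where p: "\<And>i j x. i < N \<Longrightarrow> j < N \<Longrightarrow> i \<noteq> j \<Longrightarrow> x \<in> {a, b} \<Longrightarrow>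
      cmod (\<omega> (star x * \<tau> (p j - p i) x) - \<omega> (star x) * \<omega> x) < t"
    using mixing_sequence[OF wm tr, of "{a, b}" t N] t(1) by auto
  \<comment> \<open>The first two pairs control the values at \<open>x\<close> and \<open>y\<close>,
    the third controls \<open>\<omega> (y * star y)\<close>, and the family factors the correlations
    of \<open>x\<close> along the differences of the \<open>p i\<close>, including the zero
    difference needed for the diagonal.\<close>
  define K where "K = {(b, a), (d, c), (d * star d, star c * c)} \<union>
      (\<lambda>(i, j). (\<tau> (p j - p i) b * star b, star a * \<tau> (p j - p i) a)) ` ({..<N} \<times> {..<N})"
  have "finite K" by (simp add: K_def)
  then obtain Q where Q: "finite Q"
    "\<And>h. \<exists>q\<in>Q. \<forall>u v. (u, v) \<in> K \<longrightarrow> cmod (\<omega> (u * \<tau> (h + q) v) - \<omega> u * \<omega> v) < t"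
    using uniform_mixing[OF wm tr _ t(1)] by blast
  \<comment> \<open>Here \<open>h\<close> stands for the final second coordinate
    \<open>h + q\<close>; only mixing on \<open>K\<close> is asked of it, and \<open>g\<close> is
    arbitrary.\<close>
  have recur: "\<exists>i<N. cmod (\<omega> a * \<omega> b * \<omega> c * \<omega> d) - \<epsilon> <
      cmod (\<omega> (\<tau> ((g + p i) + h) a * \<tau> (g + p i) b * \<tau> h c * d))"
    if h: "\<And>u v. (u, v) \<in> K \<Longrightarrow> cmod (\<omega> (u * \<tau> h v) - \<omega> u * \<omega> v) < t" for g h
  proof -
    define x where "x = \<tau> h a * b"
    define y where "y = \<tau> h c * d"
    have tr': "\<omega> (u * v) = \<omega> (v * u)" for u v
      using tr by (simp add: tracial_def)
    have x: "cmod (\<omega> x - \<omega> a * \<omega> b) < t"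
      using h[of b a] by (simp add: K_def x_def tr'[of b] mult.commute)
    have y: "cmod (\<omega> y - \<omega> c * \<omega> d) < t"
      using h[of d c] by (simp add: K_def y_def tr'[of d] mult.commute)
    have "\<omega> (y * star y) = \<omega> (\<tau> h c * (d * star d * \<tau> h (star c)))"
      by (simp add: y_def star_mult tau_star mult.assoc)
    also have "\<dots> = \<omega> (d * star d * \<tau> h (star c * c))"
      by (subst tr') (simp add: tau_mult mult.assoc)
    finally have "cmod (\<omega> (y * star y) - \<omega> (star c * c) * \<omega> (d * star d)) < t"
      using h[of "d * star d" "star c * c"] by (simp add: K_def mult.commute)
    then have "cmod (\<omega> (y * star y)) \<le> Y"
      using t norm_triangle_sub[of "\<omega> (y * star y)" "\<omega> (star c * c) * \<omega> (d * star d)"]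
      by (simp add: Y_def norm_mult)
    then have yy: "Re (\<omega> (y * star y)) \<le> Y"
      using complex_Re_le_cmod order_trans by blast
    \<comment> \<open>Commutativity of the group lets the shift \<open>h\<close> be pulled out of
      both factors containing \<open>a\<close>, and the trace brings the resulting factor to the
      end.\<close>
    have xx: "cmod (\<omega> (star x * \<tau> (p j - p i) x) -
        \<omega> (star a * \<tau> (p j - p i) a) * \<omega> (star b * \<tau> (p j - p i) b)) < t"
      if "i < N" "j < N" for i j
    proof -
      let ?s = "p j - p i"
      have "\<omega> (star x * \<tau> ?s x) = \<omega> (star b * (\<tau> h (star a * \<tau> ?s a) * \<tau> ?s b))"
        by (simp add: x_def star_mult tau_star tau_mult tau_tau mult.assoc add.commute)
      also have "\<dots> = \<omega> (\<tau> ?s b * star b * \<tau> h (star a * \<tau> ?s a))"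
        by (subst tr', subst mult.assoc, subst tr') (simp add: mult.assoc)
      finally have "\<omega> (star x * \<tau> ?s x) = \<omega> (\<tau> ?s b * star b * \<tau> h (star a * \<tau> ?s a))" .
      moreover have "(\<tau> ?s b * star b, star a * \<tau> ?s a) \<in> K"
        using that by (force simp: K_def)
      then have "cmod (\<omega> (\<tau> ?s b * star b * \<tau> h (star a * \<tau> ?s a)) -
          \<omega> (\<tau> ?s b * star b) * \<omega> (star a * \<tau> ?s a)) < t"
        by (rule h)
      ultimately show ?thesis
        using tr'[of "\<tau> ?s b" "star b"] by (simp add: mult.commute)
    qed
    have x2: "cmod (\<omega> x) \<le> A * B + t"
      using x norm_triangle_sub[of "\<omega> x" "\<omega> a * \<omega> b"] by (simp add: A_def B_def norm_mult)
    have star_self: "\<omega> (star z) * \<omega> z = of_real ((cmod (\<omega> z))\<^sup>2)" for z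
      unfolding complex_norm_square by (simp add: state_star mult.commute)
    \<comment> \<open>The correlation is compared in turn with \<open>u * v\<close>, with A^2 B^2
      and with the squared modulus of \<open>\<omega> x\<close>. The three errors are the three
      summands of \<open>C\<close>, each times \<open>t\<close>.\<close>
    have off: "cmod (\<omega> (star x * \<tau> (p j - p i) x) - \<omega> (star x) * \<omega> x) \<le> C / N"
      if ij: "i < N" "j < N" "i \<noteq> j" for i j
    proof -
      define u where "u = \<omega> (star a * \<tau> (p j - p i) a)"
      define v where "v = \<omega> (star b * \<tau> (p j - p i) b)"
      have u: "cmod (u - of_real (A\<^sup>2)) \<le> t" and v: "cmod (v - of_real (B\<^sup>2)) \<le> t"
        using p[OF ij, of a] p[OF ij, of b] by (simp_all add: u_def v_def A_def B_def star_self less_imp_le)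
      have "cmod v \<le> cmod (of_real (B\<^sup>2) :: complex) + cmod (v - of_real (B\<^sup>2))"
        by (rule norm_triangle_sub)
      then have v': "cmod v \<le> B\<^sup>2 + 1"
        using v t by (simp add: norm_power)
      have "u * v - of_real (A\<^sup>2 * B\<^sup>2) = (u - of_real (A\<^sup>2)) * v + of_real (A\<^sup>2) * (v - of_real (B\<^sup>2))"
        by (simp add: algebra_simps)
      also have "cmod \<dots> \<le> t * (B\<^sup>2 + 1) + A\<^sup>2 * t"
        using u v v' t by (intro norm_triangle_mono) (auto simp: norm_mult norm_power intro!: mult_mono)
      finally have 1: "cmod (u * v - of_real (A\<^sup>2 * B\<^sup>2)) \<le> t * (A\<^sup>2 + B\<^sup>2 + 1)"
        by (simp add: algebra_simps)
      \<comment> \<open>Difference of squares: this factor is small, and the factor A B + |\<omega>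
        x| is at most 2 A B + 1.\<close>
      have "\<bar>A * B - cmod (\<omega> x)\<bar> \<le> t"
        using x norm_triangle_ineq3[of "\<omega> x" "\<omega> a * \<omega> b"]
        by (simp add: A_def B_def norm_mult abs_minus_commute)
      then have "\<bar>A * B - cmod (\<omega> x)\<bar> * \<bar>A * B + cmod (\<omega> x)\<bar> \<le> t * (2 * A * B + 1)"
        using x2 t AB by (intro mult_mono) auto
      moreover have "\<bar>A * B - cmod (\<omega> x)\<bar> * \<bar>A * B + cmod (\<omega> x)\<bar> =
          cmod (of_real (A\<^sup>2 * B\<^sup>2) - \<omega> (star x) * \<omega> x)"
        unfolding star_self abs_mult[symmetric] of_real_diff[symmetric] norm_of_real
        by (simp add: algebra_simps power2_eq_square)
      ultimately have 2: "cmod (of_real (A\<^sup>2 * B\<^sup>2) - \<omega> (star x) * \<omega> x) \<le> t * (2 * A * B + 1)"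
        by simp
      have "cmod (\<omega> (star x * \<tau> (p j - p i) x) - \<omega> (star x) * \<omega> x) \<le>
          cmod (\<omega> (star x * \<tau> (p j - p i) x) - u * v) + (cmod (u * v - of_real (A\<^sup>2 * B\<^sup>2)) +
          cmod (of_real (A\<^sup>2 * B\<^sup>2) - \<omega> (star x) * \<omega> x))"
        by norm
      also have "\<dots> \<le> t + (t * (A\<^sup>2 + B\<^sup>2 + 1) + t * (2 * A * B + 1))"
        using 1 2 xx[OF ij(1,2)] by (intro add_mono) (simp_all add: u_def v_def)
      also have "\<dots> = C / N"
        by (simp add: C_def t_def algebra_simps add_divide_distrib)
      finally show ?thesis .
    qed
    have diag: "cmod (\<omega> (star x * x) - \<omega> (star x) * \<omega> x) \<le> D"
    proof -
      have "cmod (\<omega> (star x * x)) \<le> cmod (\<omega> (star a * a) * \<omega> (star b * b)) + 1"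
        using xx[OF N(1) N(1)] t norm_triangle_sub[of "\<omega> (star x * x)" "\<omega> (star a * a) * \<omega> (star b * b)"]
        by (simp add: tau_0)
      moreover have "cmod (\<omega> (star x) * \<omega> x) \<le> (A * B + 1)\<^sup>2"
        unfolding star_self norm_of_real abs_power2 using x2 t by (intro power_mono) auto
      ultimately show ?thesis
        using norm_triangle_ineq4[of "\<omega> (star x * x)" "\<omega> (star x) * \<omega> x"]
        by (simp add: D_def norm_mult)
    qed
    have "(\<Sum>i<N. cmod (\<omega> (y * \<tau> (g + p i) x) - \<omega> y * \<omega> x)) \<le>
        sqrt (Re (\<omega> (y * star y))) * sqrt (N * (C + D))"
      by (rule sum_mixing_le[OF C off diag])
    also have "\<dots> \<le> sqrt Y * sqrt (N * (C + D))"
      using yy C by (intro mult_right_mono real_sqrt_le_mono) (auto simp: D_def AB)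
    also have "\<dots> = (\<Sum>i<N. sqrt Y * sqrt ((C + D) / N))"
      using N(1) by (simp add: sqrt_of_nat_mult)
    \<comment> \<open>Since \<open>N > 0\<close>, some term does not exceed the bound on the
      mean.\<close>
    finally obtain i where i: "i < N"
      "cmod (\<omega> (y * \<tau> (g + p i) x) - \<omega> y * \<omega> x) \<le> sqrt Y * sqrt ((C + D) / N)"
      using N(1) sum_strict_mono[of "{..<N}" "\<lambda>i. sqrt Y * sqrt ((C + D) / N)"
          "\<lambda>i. cmod (\<omega> (y * \<tau> (g + p i) x) - \<omega> y * \<omega> x)"]
      by (force simp: not_le)
    have "\<omega> (\<tau> ((g + p i) + h) a * \<tau> (g + p i) b * \<tau> h c * d) = \<omega> (y * \<tau> (g + p i) x)"
      by (subst tr') (simp add: x_def y_def tau_mult tau_tau mult.assoc)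
    moreover have "cmod (\<omega> y * \<omega> x - \<omega> a * \<omega> b * \<omega> c * \<omega> d) \<le> L / N"
    proof -
      have "\<omega> y * \<omega> x - \<omega> a * \<omega> b * \<omega> c * \<omega> d =
          (\<omega> y - \<omega> c * \<omega> d) * \<omega> x + \<omega> c * \<omega> d * (\<omega> x - \<omega> a * \<omega> b)"
        by (simp add: algebra_simps)
      also have "cmod \<dots> \<le> t * (A * B + 1) + cmod (\<omega> c * \<omega> d) * t"
      proof (rule norm_triangle_mono)
        show "cmod ((\<omega> y - \<omega> c * \<omega> d) * \<omega> x) \<le> t * (A * B + 1)"
          unfolding norm_mult[of _ "\<omega> x"] using x2 y t by (intro mult_mono) auto
        show "cmod (\<omega> c * \<omega> d * (\<omega> x - \<omega> a * \<omega> b)) \<le> cmod (\<omega> c * \<omega> d) * t"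
          unfolding norm_mult[of "\<omega> c * \<omega> d"] using x by (intro mult_left_mono) auto
      qed
      also have "\<dots> = L / N"
        by (simp add: L_def t_def algebra_simps add_divide_distrib)
      finally show ?thesis .
    qed
    \<comment> \<open>The two remaining errors add up to less than \<epsilon> by the choice of
      \<open>N\<close>.\<close>
    ultimately show ?thesis
      using i N(2) norm_triangle_ineq2[of "\<omega> a * \<omega> b * \<omega> c * \<omega> d" "\<omega> y * \<omega> x"]
        norm_triangle_ineq2[of "\<omega> y * \<omega> x" "\<omega> (y * \<tau> (g + p i) x)"]
      by (intro exI[of _ i]) (auto simp: norm_minus_commute)
  qed
  show ?thesis
  proof (intro exI conjI allI)
    show "finite (p ` {..<N})" "finite Q" using Q(1) by auto
    fix g h
    obtain q where "q \<in> Q" "\<And>u v. (u, v) \<in> K \<Longrightarrow> cmod (\<omega> (u * \<tau> (h + q) v) - \<omega> u * \<omega> v) < t"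
      using Q(2)[of h] by blast
    with recur[of "h + q" g] show "\<exists>p\<in>p ` {..<N}. \<exists>q\<in>Q. cmod (\<omega> a * \<omega> b * \<omega> c * \<omega> d) - \<epsilon> <
      cmod (\<omega> (\<tau> ((g + p) + (h + q)) a * \<tau> (g + p) b * \<tau> (h + q) c * d))"
      by blast
  qed
qed

end

section \<open>Translates of finite sets inside Folner sets\<close>

lemma mem_right_translate: "g \<in> right_translate V h \<longleftrightarrow> g - h \<in> V"
  by (force simp: right_translate_def intro: exI[of _ "g - h"])

text \<open>If no translate of \<open>P\<close> lay in \<open>\<Lambda> \<alpha>\<close>, every
  point of that set would be moved out of it by some \<open>p\<close>. The set would then be covered
  by its symmetric differences with its translates by \<open>- p\<close>, whose measures eventually
  sum to less than its own.\<close>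

lemma (in right_invariant_measure_group) eventually_folner_contains:
  assumes "folner_net \<mu> F \<Lambda>" "finite P"
  shows "\<forall>\<^sub>F \<alpha> in F. \<exists>g. \<forall>p\<in>P. g + p \<in> \<Lambda> \<alpha>"
proof -
  let ?D = "\<lambda>\<alpha> p. sym_diff (\<Lambda> \<alpha>) (right_translate (\<Lambda> \<alpha>) (- p))"
  have "((\<lambda>\<alpha>. \<Sum>p\<in>P. emeasure \<mu> (?D \<alpha> p) / emeasure \<mu> (\<Lambda> \<alpha>)) \<longlongrightarrow> (\<Sum>p\<in>P. 0)) F"
    using assms(1) unfolding folner_net_def by (intro tendsto_sum) blast
  then have "\<forall>\<^sub>F \<alpha> in F. (\<Sum>p\<in>P. emeasure \<mu> (?D \<alpha> p) / emeasure \<mu> (\<Lambda> \<alpha>)) < 1"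
    by (intro order_tendstoD(2)) auto
  moreover have "\<forall>\<^sub>F \<alpha> in F. \<Lambda> \<alpha> \<in> sets \<mu> \<and> 0 < emeasure \<mu> (\<Lambda> \<alpha>) \<and> emeasure \<mu> (\<Lambda> \<alpha>) < \<infinity>"
    using assms(1) by (auto simp: folner_net_def)
  ultimately show ?thesis
  proof eventually_elim
    case (elim \<alpha>)
    show ?case
    proof (rule ccontr)
      assume "\<not> ?thesis"
      then have "\<Lambda> \<alpha> \<subseteq> (\<Union>p\<in>P. ?D \<alpha> p)"
        by (force simp: mem_right_translate)
      moreover have "?D \<alpha> p \<in> sets \<mu>" for p
        using elim right_translate_sets by auto
      ultimately have "emeasure \<mu> (\<Lambda> \<alpha>) \<le> (\<Sum>p\<in>P. emeasure \<mu> (?D \<alpha> p))"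
        using assms(2) by (intro order_trans[OF emeasure_mono emeasure_subadditive_finite]) auto
      then have "emeasure \<mu> (\<Lambda> \<alpha>) / emeasure \<mu> (\<Lambda> \<alpha>) \<le>
          (\<Sum>p\<in>P. emeasure \<mu> (?D \<alpha> p)) / emeasure \<mu> (\<Lambda> \<alpha>)"
        by (rule divide_right_mono_ennreal)
      also have "\<dots> = (\<Sum>p\<in>P. emeasure \<mu> (?D \<alpha> p) / emeasure \<mu> (\<Lambda> \<alpha>))"
        by (simp add: divide_ennreal_def sum_distrib_right)
      finally show False
        using elim ennreal_divide_self[of "emeasure \<mu> (\<Lambda> \<alpha>)"] by auto
    qed
  qed
qed


section \<open>Both statements from the finite sets of shifts\<close>

theorem corollary5p7:
  fixes \<mu> :: "'g::{topological_ab_group_add, second_countable_topology} measure"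
    and \<omega> :: "'a::cstar_algebra \<Rightarrow> complex"
    and \<tau> :: "'g \<Rightarrow> 'a \<Rightarrow> 'a"
    and \<Lambda>1 \<Lambda>2 :: "nat \<Rightarrow> 'g set"
    and \<epsilon> :: real
    and a b c d :: 'a
  assumes "cstar_dynamical_system \<mu> \<omega> \<tau>"
    and "weakly_mixing \<mu> \<omega> \<tau>"
    and "tracial \<omega>"
    and "sets \<mu> = sets borel"
    and "sigma_finite_measure \<mu>"
    and "\<And>a1 a2 a3 a4 a5 a6.
      (\<lambda>((g, h), (j, k)). \<omega> (\<tau> h a1 * \<tau> g a2 * \<tau> (g + h) a3 * \<tau> (j + k) a4 * \<tau> j a5 * \<tau> k a6))
        \<in> borel_measurable ((\<mu> \<Otimes>\<^sub>M \<mu>) \<Otimes>\<^sub>M (\<mu> \<Otimes>\<^sub>M \<mu>))"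
    and "uniform_folner_net \<mu> sequentially \<Lambda>1"
    and "uniform_folner_net \<mu> sequentially \<Lambda>2"
    and "tempelman \<mu> sequentially \<Lambda>1"
    and "tempelman \<mu> sequentially \<Lambda>2"
    and "folner_net \<mu> sequentially (\<lambda>n. quotient_set (\<Lambda>1 n))"
    and "folner_net \<mu> sequentially (\<lambda>n. quotient_set (\<Lambda>2 n))"
    and "\<epsilon> > 0"
  shows
    "(asymptotically_abelian \<mu> \<tau> sequentially \<Lambda>1 \<longrightarrow>
        (\<exists>n0. \<forall>n>n0. \<exists>g\<in>\<Lambda>2 n. \<exists>h\<in>\<Lambda>1 n.
           cmod (\<omega> (\<tau> (g + h) a * \<tau> g b * \<tau> h c * d)) > cmod (\<omega> a * \<omega> b * \<omega> c * \<omega> d) - \<epsilon>)) \<and>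
     (is_counting_measure \<mu> \<and> uniformly_asymptotically_abelian \<mu> \<tau> sequentially \<Lambda>1 \<longrightarrow>
        (\<exists>n. \<forall>g1 g2. \<exists>g\<in>right_translate (\<Lambda>2 n) g2. \<exists>h\<in>right_translate (\<Lambda>1 n) g1.
           cmod (\<omega> (\<tau> (g + h) a * \<tau> g b * \<tau> h c * d)) > cmod (\<omega> a * \<omega> b * \<omega> c * \<omega> d) - \<epsilon>) \<and>
        relatively_dense {(g, h).
           cmod (\<omega> (\<tau> (g + h) a * \<tau> g b * \<tau> h c * d)) > cmod (\<omega> a * \<omega> b * \<omega> c * \<omega> d) - \<epsilon>})"
proof -
  interpret cstar_dynamical_system \<mu> \<omega> \<tau> by (rule assms(1))
  let ?E = "\<lambda>g h. cmod (\<omega> (\<tau> (g + h) a * \<tau> g b * \<tau> h c * d)) > cmod (\<omega> a * \<omega> b * \<omega> c * \<omega> d) - \<epsilon>"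
  obtain P Q where PQ: "finite P" "finite Q"
    "\<forall>g h. \<exists>p\<in>P. \<exists>q\<in>Q. ?E (g + p) (h + q)"
    using four_fold_recurrence[OF assms(2,3,13), of a b c d] by blast
  have "\<forall>\<^sub>F n in sequentially. (\<exists>g. \<forall>p\<in>P. g + p \<in> \<Lambda>2 n) \<and> (\<exists>h. \<forall>q\<in>Q. h + q \<in> \<Lambda>1 n)"
    using assms(7,8) PQ(1,2)
    by (intro eventually_conj eventually_folner_contains) (auto simp: uniform_folner_net_def)
  then obtain n0 where n0: "\<And>n. n \<ge> n0 \<Longrightarrow> (\<exists>g. \<forall>p\<in>P. g + p \<in> \<Lambda>2 n) \<and> (\<exists>h. \<forall>q\<in>Q. h + q \<in> \<Lambda>1 n)"
    by (auto simp: eventually_sequentially)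
  have translates: "\<exists>g\<in>right_translate (\<Lambda>2 n) g2. \<exists>h\<in>right_translate (\<Lambda>1 n) g1. ?E g h"
    if n: "n \<ge> n0" for n g1 g2
  proof -
    obtain g h where gh: "\<And>p. p \<in> P \<Longrightarrow> g + p \<in> \<Lambda>2 n" "\<And>q. q \<in> Q \<Longrightarrow> h + q \<in> \<Lambda>1 n"
      using n0[OF n] by blast
    \<comment> \<open>Starting from \<open>g + g2\<close> and \<open>h + g1\<close> puts the points
      into the translated Folner sets, with the same \<open>n\<close> for all \<open>g1\<close> and
      \<open>g2\<close>.\<close>
    obtain p q where "p \<in> P" "q \<in> Q" "?E (g + g2 + p) (h + g1 + q)"
      using PQ(3)[rule_format, of "g + g2" "h + g1"] by blast
    moreover from this have "g + g2 + p \<in> right_translate (\<Lambda>2 n) g2"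
      and "h + g1 + q \<in> right_translate (\<Lambda>1 n) g1"
      using gh(1)[of p] gh(2)[of q] by (simp_all add: mem_right_translate algebra_simps)
    ultimately show ?thesis by blast
  qed
  have dense: "relatively_dense {(g, h). ?E g h}"
    unfolding relatively_dense_def
  proof (intro exI conjI)
    \<comment> \<open>Each pair is carried into the set by some element of
      \<open>P \<times> Q\<close>, so the negatives of these elements carry the set onto the whole
      group.\<close>
    show "finite (uminus ` (P \<times> Q))" using PQ(1,2) by simp
    show "product_set (uminus ` (P \<times> Q)) {(g, h). ?E g h} = UNIV"
    proof (intro UNIV_eq_I[symmetric] allI, clarify)
      fix g h
      obtain p q where pq: "p \<in> P" "q \<in> Q" "?E (g + p) (h + q)"
        using PQ(3) by blast
      then have "- (p, q) \<in> uminus ` (P \<times> Q)" "(g + p, h + q) \<in> {(g, h). ?E g h}"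
        "(g, h) = - (p, q) + (g + p, h + q)"
        by (blast, simp_all)
      then show "(g, h) \<in> product_set (uminus ` (P \<times> Q)) {(g, h). ?E g h}"
        unfolding product_set_def by blast
    qed
  qed
  \<comment> \<open>Statement (1) is the case of zero translates.\<close>
  have "right_translate V 0 = V" for V :: "'g set"
    by (auto simp: mem_right_translate)
  then have "\<exists>g\<in>\<Lambda>2 n. \<exists>h\<in>\<Lambda>1 n. ?E g h" if "n > n0" for n
    using translates[of n 0 0] that by simp
  then show ?thesis
    using translates[OF order_refl] dense by (intro conjI impI exI[of _ n0] allI)
qed

end
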